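(* Let $\mathcal R=(G,\Lambda,N)$ be a complete rootoid, and for each $a\in\mathrm{ob}(G)$ let $\omega(a)$ denote the maximum element of ${}_aG$ in the weak right order. (a) There is a unique functor $d\colon G\to G$ such that there is a natural isomorphism $\omega\colon d\to\mathrm{Id}_G$ with component $\omega_a=\omega(a)$ at each $a\in\mathrm{ob}(G)$. (b) Let $D:=(d,\Lambda\omega^{*})$, where $\omega^{*}\colon\mathrm{Id}_G\to d$ is the inverse of $\omega$, so that $\Lambda\omega^*\colon\Lambda\to\Lambda d$ has components $\Lambda(\omega(a)^{-1})$. Then $D\in\mathrm{Aut}_{\mathbf{RdE}}(\mathcal R)$ and $D^{2}=\mathrm{Id}_{\mathcal R}$.
   Context: A groupoid is a small category in which every morphism is invertible; ${}_aG$ is the set of morphisms of $G$ with codomain $a$. A Boolean ring is a (possibly non-unital) ring in which every element is idempotent, partially ordered by $x\subseteq y\iff xy=x$; write $x\cap y=xy$, $\emptyset=0$. $\mathbf{BRng}$ is the category of Boolean rings and (not necessarily unital) ring homomorphisms. A protorootoid is a triple $\mathcal R=(G,\Lambda,N)$ with $G$ a groupoid, $\Lambda\colon G\to\mathbf{BRng}$ a functor, and $N$ assigning to each $g\in{}_aG$ an element $N(g)\in\Lambda(a)$ such that $N(gh)=N(g)+\Lambda(g)(N(h))$ whenever $gh$ is defined. The weak order at $a$ is the subposet ${}_a\mathcal L=\{N(g)\mid g\in{}_aG\}$ of $\Lambda(a)$; the weak right preorder on ${}_aG$ is $x\le y\iff N(x)\subseteq N(y)$. $\mathcal R$ is a rootoid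 if: (i) for $g,h\in{}_aG$, $N(g)=N(h)$ implies $g=h$ (so weak right preorders are partial orders); (ii) each ${}_a\mathcal L$ is a complete meet semilattice (every non-empty subset has a meet); (iii) if $A_i,B\in{}_a\mathcal L$ with $A_i\cap B=\emptyset$ for all $i$ and $A=\bigvee_iA_i$ exists in ${}_a\mathcal L$, then $A\cap B=\emptyset$. It is complete if each ${}_a\mathcal L$ is a complete lattice; then each ${}_aG$ has a maximum element. The category $\mathbf{Prd}$ of protorootoids: a morphism $(G,\Lambda,N)\to(G',\Lambda',N')$ is a pair $(\alpha,\mu)$ with $\alpha\colon G\to G'$ a functor and $\mu\colon\Lambda\to\Lambda'\alpha$ a natural transformation with $\mu_a(N(g))=N'(\alpha(g))$ for all $g\in{}_aG$; composition is $(\alpha',\mu')(\alpha,\mu)=(\alpha'\alpha,(\mu'\alpha)\mu)$. For such a morphism let ${}_a\alpha\colon{}_aG\to{}_{\alpha(a)}G'$ be the map induced by $\alpha$. The category $\mathbf{RdE}$ of rootoids and local embeddings is the subcategory of $\mathbf{Prd}$ whose objects are rootoids and whose morphisms are the morphisms $(\alpha,\mu)$ of $\mathbf{Prd}$ between rootoids such that for every $a\in\mathrm{ob}(G)$: (1) ${}_a\alpha$ preserves the minimum element, all meets of non-empty subsets and all joins of subsets that exist in ${}_aG$; (2) (adjunction orthogonality) if $g\in{}_aG$ and $g'\in{}_{\alpha(a)}G'$ lies in the order ideal generated by the image of ${}_a\alpha$ and $N'(\alpha(g))\cap N'(g')=\emptyset$, then $N(g)\cap N({}_a\alpha^{\perp}(g'))=\emptyset$,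 where ${}_a\alpha^{\perp}(g'):=\min\{x\in{}_aG\mid g'\le\alpha(x)\}$; (3) ${}_a\alpha$ is injective and its image is closed in ${}_{\alpha(a)}G'$ under meets of non-empty subsets and under those joins of non-empty subsets which exist in ${}_{\alpha(a)}G'$. *)

theory Defs
  imports "HOL-Library.FuncSet" "HOL-Algebra.Ring" "HOL-Algebra.Complete_Lattice"
begin

section \<open>Small categories, groupoids, functors\<close>

text \<open>A composite \<open>g \<cdot>\<^bsub>C\<^esub> h\<close> (first \<open>h\<close>, then \<open>g\<close>) is meaningful when \<open>Dom C g = Cod C h\<close>.\<close>

record ('o, 'm) cat =
  Ob  :: "'o set"
  Mor :: "'m set"
  Dom :: "'m \<Rightarrow> 'o"
  Cod :: "'m \<Rightarrow> 'o"
  Ide :: "'o \<Rightarrow> 'm"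
  Cmp :: "'m \<Rightarrow> 'm \<Rightarrow> 'm"  (infixl \<open>\<cdot>\<index>\<close> 70)

definition hom_set :: "('o, 'm) cat \<Rightarrow> 'o \<Rightarrow> 'o \<Rightarrow> 'm set" where
  "hom_set C a b = {f \<in> Mor C. Dom C f = a \<and> Cod C f = b}"

locale small_category =
  fixes C :: "('o, 'm) cat" (structure)
  assumes Dom_Ob: "f \<in> Mor C \<Longrightarrow> Dom C f \<in> Ob C"
    and Cod_Ob: "f \<in> Mor C \<Longrightarrow> Cod C f \<in> Ob C"
    and Ide_hom: "a \<in> Ob C \<Longrightarrow> Ide C a \<in> hom_set C a a"
    and Cmp_hom: "\<lbrakk>f \<in> hom_set C a b; g \<in> hom_set C b c\<rbrakk> \<Longrightarrow> g \<cdot> f \<in> hom_set C a c"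
    and Cmp_assoc: "\<lbrakk>f \<in> hom_set C a b; g \<in> hom_set C b c; h \<in> hom_set C c d\<rbrakk>
      \<Longrightarrow> (h \<cdot> g) \<cdot> f = h \<cdot> (g \<cdot> f)"
    and Cmp_Ide: "f \<in> Mor C \<Longrightarrow> f \<cdot> Ide C (Dom C f) = f"
    and Ide_Cmp: "f \<in> Mor C \<Longrightarrow> Ide C (Cod C f) \<cdot> f = f"

definition is_inverse :: "('o, 'm) cat \<Rightarrow> 'm \<Rightarrow> 'm \<Rightarrow> bool" where
  "is_inverse C f g \<longleftrightarrow> f \<in> Mor C \<and> g \<in> hom_set C (Cod C f) (Dom C f) \<and>
     g \<cdot>\<^bsub>C\<^esub> f = Ide C (Dom C f) \<and> f \<cdot>\<^bsub>C\<^esub> g = Ide C (Cod C f)"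

definition inv_mor :: "('o, 'm) cat \<Rightarrow> 'm \<Rightarrow> 'm" where
  "inv_mor C f = (THE g. is_inverse C f g)"

locale groupoid = small_category +
  assumes invertible: "f \<in> Mor C \<Longrightarrow> \<exists>g. is_inverse C f g"

text \<open>The set of morphisms with codomain \<open>a\<close>.\<close>

definition into :: "('o, 'm) cat \<Rightarrow> 'o \<Rightarrow> 'm set" where
  "into C a = {f \<in> Mor C. Cod C f = a}"

record ('o, 'm, 'p, 'n) cat_map =
  on_ob  :: "'o \<Rightarrow> 'p"
  on_mor :: "'m \<Rightarrow> 'n"

text \<open>Functors are required to be \<^const>\<open>extensional\<close> on objects and on morphisms (as are the
  components of natural transformations of ring-valued functors below), so that HOL equality of
  the representing data is equality of functors.\<close>

locale is_functor = dom?: small_category C + cod?: small_category D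
  for C :: "('o, 'm) cat" and D :: "('p, 'n) cat" and F :: "('o, 'm, 'p, 'n) cat_map" +
  assumes on_ob_ext: "on_ob F \<in> extensional (Ob C)"
    and on_mor_ext: "on_mor F \<in> extensional (Mor C)"
    and on_ob_closed: "a \<in> Ob C \<Longrightarrow> on_ob F a \<in> Ob D"
    and on_mor_hom: "f \<in> hom_set C a b \<Longrightarrow> on_mor F f \<in> hom_set D (on_ob F a) (on_ob F b)"
    and on_mor_Ide: "a \<in> Ob C \<Longrightarrow> on_mor F (Ide C a) = Ide D (on_ob F a)"
    and on_mor_Cmp: "\<lbrakk>f \<in> hom_set C a b; g \<in> hom_set C b c\<rbrakk>
      \<Longrightarrow> on_mor F (g \<cdot>\<^bsub>C\<^esub> f) = on_mor F g \<cdot>\<^bsub>D\<^esub> on_mor F f"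

definition id_functor :: "('o, 'm) cat \<Rightarrow> ('o, 'm, 'o, 'm) cat_map" where
  "id_functor C = \<lparr>on_ob = (\<lambda>a\<in>Ob C. a), on_mor = (\<lambda>f\<in>Mor C. f)\<rparr>"

definition comp_functor :: "('o, 'm) cat \<Rightarrow> ('p, 'n, 'q, 'k) cat_map \<Rightarrow>
    ('o, 'm, 'p, 'n) cat_map \<Rightarrow> ('o, 'm, 'q, 'k) cat_map" where
  "comp_functor C F' F = \<lparr>on_ob = compose (Ob C) (on_ob F') (on_ob F),
                          on_mor = compose (Mor C) (on_mor F') (on_mor F)\<rparr>"

definition natural_transformation :: "('o, 'm) cat \<Rightarrow> ('p, 'n) cat \<Rightarrow>
    ('o, 'm, 'p, 'n) cat_map \<Rightarrow> ('o, 'm, 'p, 'n) cat_map \<Rightarrow> ('o \<Rightarrow> 'n) \<Rightarrow> bool" where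
  "natural_transformation C D F F' \<tau> \<longleftrightarrow>
     is_functor C D F \<and> is_functor C D F' \<and>
     (\<forall>a\<in>Ob C. \<tau> a \<in> hom_set D (on_ob F a) (on_ob F' a)) \<and>
     (\<forall>f\<in>Mor C. on_mor F' f \<cdot>\<^bsub>D\<^esub> \<tau> (Dom C f) = \<tau> (Cod C f) \<cdot>\<^bsub>D\<^esub> on_mor F f)"

definition natural_isomorphism :: "('o, 'm) cat \<Rightarrow> ('p, 'n) cat \<Rightarrow>
    ('o, 'm, 'p, 'n) cat_map \<Rightarrow> ('o, 'm, 'p, 'n) cat_map \<Rightarrow> ('o \<Rightarrow> 'n) \<Rightarrow> bool" where
  "natural_isomorphism C D F F' \<tau> \<longleftrightarrow> natural_transformation C D F F' \<tau> \<and>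
     (\<forall>a\<in>Ob C. \<exists>g. is_inverse D (\<tau> a) g)"


section \<open>Boolean rings\<close>

text \<open>Boolean rings need not be unital, whereas the ring locales of HOL-Algebra are unital. The
  record \<^typ>\<open>'b ring\<close> is used with its field \<^const>\<open>one\<close> ignored throughout.\<close>

locale boolean_rng = abelian_group B for B :: "'b ring" (structure) +
  assumes mult_closed: "\<lbrakk>x \<in> carrier B; y \<in> carrier B\<rbrakk> \<Longrightarrow> x \<otimes> y \<in> carrier B"
    and mult_assoc: "\<lbrakk>x \<in> carrier B; y \<in> carrier B; z \<in> carrier B\<rbrakk>
      \<Longrightarrow> (x \<otimes> y) \<otimes> z = x \<otimes> (y \<otimes> z)"
    and distrib_right: "\<lbrakk>x \<in> carrier B; y \<in> carrier B; z \<in> carrier B\<rbrakk>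
      \<Longrightarrow> (x \<oplus> y) \<otimes> z = x \<otimes> z \<oplus> y \<otimes> z"
    and distrib_left: "\<lbrakk>x \<in> carrier B; y \<in> carrier B; z \<in> carrier B\<rbrakk>
      \<Longrightarrow> z \<otimes> (x \<oplus> y) = z \<otimes> x \<oplus> z \<otimes> y"
    and mult_idem: "x \<in> carrier B \<Longrightarrow> x \<otimes> x = x"

definition brng_hom :: "'b ring \<Rightarrow> 'c ring \<Rightarrow> ('b \<Rightarrow> 'c) set" where
  "brng_hom B B' = {h \<in> carrier B \<rightarrow> carrier B'. \<forall>x\<in>carrier B. \<forall>y\<in>carrier B.
     h (x \<oplus>\<^bsub>B\<^esub> y) = h x \<oplus>\<^bsub>B'\<^esub> h y \<and> h (x \<otimes>\<^bsub>B\<^esub> y) = h x \<otimes>\<^bsub>B'\<^esub> h y}"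

definition brng_le :: "'b ring \<Rightarrow> 'b \<Rightarrow> 'b \<Rightarrow> bool" where
  "brng_le B x y \<longleftrightarrow> x \<otimes>\<^bsub>B\<^esub> y = x"


section \<open>Protorootoids and rootoids\<close>

text \<open>The functor \<open>\<Lambda>\<close> is given by \<open>\<Lambda>(a) = Lam R a\<close> on objects and \<open>\<Lambda>(g) = act R g\<close> on
  morphisms; only the values of \<open>act R g\<close> on \<open>\<Lambda>(Dom g)\<close> matter. All the rings
  \<open>\<Lambda>(a)\<close> have their elements in one type, with no assumption on how their carriers overlap.\<close>

record ('o, 'm, 'b) prd =
  Grp :: "('o, 'm) cat"
  Lam :: "'o \<Rightarrow> 'b ring"
  act :: "'m \<Rightarrow> 'b \<Rightarrow> 'b"
  Nof :: "'m \<Rightarrow> 'b"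

locale protorootoid = groupoid "Grp R" for R :: "('o, 'm, 'b) prd" +
  assumes Lam_boolean: "a \<in> Ob (Grp R) \<Longrightarrow> boolean_rng (Lam R a)"
    and act_hom: "g \<in> hom_set (Grp R) b a \<Longrightarrow> act R g \<in> brng_hom (Lam R b) (Lam R a)"
    and act_Ide: "\<lbrakk>a \<in> Ob (Grp R); x \<in> carrier (Lam R a)\<rbrakk> \<Longrightarrow> act R (Ide (Grp R) a) x = x"
    and act_Cmp: "\<lbrakk>h \<in> hom_set (Grp R) c b; g \<in> hom_set (Grp R) b a; x \<in> carrier (Lam R c)\<rbrakk>
      \<Longrightarrow> act R (g \<cdot>\<^bsub>Grp R\<^esub> h) x = act R g (act R h x)"
    and Nof_closed: "g \<in> into (Grp R) a \<Longrightarrow> Nof R g \<in> carrier (Lam R a)"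
    and Nof_Cmp: "\<lbrakk>h \<in> hom_set (Grp R) c b; g \<in> hom_set (Grp R) b a\<rbrakk>
      \<Longrightarrow> Nof R (g \<cdot>\<^bsub>Grp R\<^esub> h) = Nof R g \<oplus>\<^bsub>Lam R a\<^esub> act R g (Nof R h)"

definition weak_order :: "('o, 'm, 'b) prd \<Rightarrow> 'o \<Rightarrow> 'b gorder" where
  "weak_order R a = \<lparr>carrier = Nof R ` into (Grp R) a, eq = (=), le = brng_le (Lam R a)\<rparr>"

definition weak_right :: "('o, 'm, 'b) prd \<Rightarrow> 'o \<Rightarrow> 'm gorder" where
  "weak_right R a = \<lparr>carrier = into (Grp R) a, eq = (=),
     le = (\<lambda>x y. brng_le (Lam R a) (Nof R x) (Nof R y))\<rparr>"

definition disjoint_at :: "('o, 'm, 'b) prd \<Rightarrow> 'o \<Rightarrow> 'b \<Rightarrow> 'b \<Rightarrow> bool" where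
  "disjoint_at R a x y \<longleftrightarrow> x \<otimes>\<^bsub>Lam R a\<^esub> y = \<zero>\<^bsub>Lam R a\<^esub>"

locale rootoid = protorootoid +
  assumes Nof_inj: "a \<in> Ob (Grp R) \<Longrightarrow> inj_on (Nof R) (into (Grp R) a)"
    and meets: "\<lbrakk>a \<in> Ob (Grp R); X \<subseteq> carrier (weak_order R a); X \<noteq> {}\<rbrakk>
      \<Longrightarrow> \<exists>m. is_glb (weak_order R a) m X"
    and join_orthogonality: "\<lbrakk>a \<in> Ob (Grp R); X \<subseteq> carrier (weak_order R a);
        y \<in> carrier (weak_order R a); \<And>x. x \<in> X \<Longrightarrow> disjoint_at R a x y;
        is_lub (weak_order R a) j X\<rbrakk> \<Longrightarrow> disjoint_at R a j y"

locale complete_rootoid = rootoid +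
  assumes complete: "a \<in> Ob (Grp R) \<Longrightarrow> complete_lattice (weak_order R a)"

definition max_elt :: "('o, 'm, 'b) prd \<Rightarrow> 'o \<Rightarrow> 'm" where
  "max_elt R a = \<top>\<^bsub>weak_right R a\<^esub>"


section \<open>The categories of protorootoids and of rootoids with local embeddings\<close>

type_synonym ('o, 'm, 'b, 'p, 'n, 'c) prd_map =
  "('o, 'm, 'p, 'n) cat_map \<times> ('o \<Rightarrow> 'b \<Rightarrow> 'c)"

definition prd_hom :: "('o, 'm, 'b) prd \<Rightarrow> ('p, 'n, 'c) prd \<Rightarrow>
    ('o, 'm, 'b, 'p, 'n, 'c) prd_map set" where
  "prd_hom R R' = {(\<alpha>, \<mu>). protorootoid R \<and> protorootoid R' \<and>
     is_functor (Grp R) (Grp R') \<alpha> \<and>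
     \<mu> \<in> extensional (Ob (Grp R)) \<and>
     (\<forall>a\<in>Ob (Grp R). \<mu> a \<in> brng_hom (Lam R a) (Lam R' (on_ob \<alpha> a)) \<and>
                     \<mu> a \<in> extensional (carrier (Lam R a))) \<and>
     (\<forall>g\<in>Mor (Grp R). \<forall>x\<in>carrier (Lam R (Dom (Grp R) g)).
        \<mu> (Cod (Grp R) g) (act R g x) = act R' (on_mor \<alpha> g) (\<mu> (Dom (Grp R) g) x)) \<and>
     (\<forall>a\<in>Ob (Grp R). \<forall>g\<in>into (Grp R) a. \<mu> a (Nof R g) = Nof R' (on_mor \<alpha> g))}"

definition prd_id :: "('o, 'm, 'b) prd \<Rightarrow> ('o, 'm, 'b, 'o, 'm, 'b) prd_map" where
  "prd_id R = (id_functor (Grp R), \<lambda>a\<in>Ob (Grp R). \<lambda>x\<in>carrier (Lam R a). x)"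

text \<open>In \<open>prd_comp R f' f\<close> the first argument is the source of \<open>f\<close>.\<close>

definition prd_comp :: "('o, 'm, 'b) prd \<Rightarrow> ('p, 'n, 'c, 'q, 'k, 'd) prd_map \<Rightarrow>
    ('o, 'm, 'b, 'p, 'n, 'c) prd_map \<Rightarrow> ('o, 'm, 'b, 'q, 'k, 'd) prd_map" where
  "prd_comp R f' f = (comp_functor (Grp R) (fst f') (fst f),
     \<lambda>a\<in>Ob (Grp R). compose (carrier (Lam R a)) (snd f' (on_ob (fst f) a)) (snd f a))"

definition order_ideal_of :: "'a gorder \<Rightarrow> 'a set \<Rightarrow> 'a set" where
  "order_ideal_of L S = {y \<in> carrier L. \<exists>x\<in>S. y \<sqsubseteq>\<^bsub>L\<^esub> x}"

text \<open>The element \<open>min {x. g' \<le> f x}\<close>, for a map \<open>f\<close> from \<open>P\<close> to \<open>P'\<close>.\<close>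

definition perp :: "'a gorder \<Rightarrow> 'b gorder \<Rightarrow> ('a \<Rightarrow> 'b) \<Rightarrow> 'b \<Rightarrow> 'a" where
  "perp P P' f g' = (THE m. least P m {x \<in> carrier P. g' \<sqsubseteq>\<^bsub>P'\<^esub> f x})"

definition preserves_meets_joins :: "'a gorder \<Rightarrow> 'b gorder \<Rightarrow> ('a \<Rightarrow> 'b) \<Rightarrow> bool" where
  "preserves_meets_joins P P' f \<longleftrightarrow>
     (\<forall>x. least P x (carrier P) \<longrightarrow> least P' (f x) (carrier P')) \<and>
     (\<forall>X m. X \<subseteq> carrier P \<longrightarrow> X \<noteq> {} \<longrightarrow> is_glb P m X \<longrightarrow> is_glb P' (f m) (f ` X)) \<and>
     (\<forall>X j. X \<subseteq> carrier P \<longrightarrow> is_lub P j X \<longrightarrow> is_lub P' (f j) (f ` X))"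

definition adjunction_orthogonal ::
    "('o, 'm, 'b) prd \<Rightarrow> ('p, 'n, 'c) prd \<Rightarrow> ('o, 'm, 'p, 'n) cat_map \<Rightarrow> 'o \<Rightarrow> bool" where
  "adjunction_orthogonal R R' \<alpha> a \<longleftrightarrow>
     (\<forall>g \<in> into (Grp R) a.
      \<forall>g' \<in> order_ideal_of (weak_right R' (on_ob \<alpha> a)) (on_mor \<alpha> ` into (Grp R) a).
        disjoint_at R' (on_ob \<alpha> a) (Nof R' (on_mor \<alpha> g)) (Nof R' g') \<longrightarrow>
        disjoint_at R a (Nof R g)
          (Nof R (perp (weak_right R a) (weak_right R' (on_ob \<alpha> a)) (on_mor \<alpha>) g')))"

definition closed_under_meets_joins :: "'a gorder \<Rightarrow> 'a set \<Rightarrow> bool" where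
  "closed_under_meets_joins P S \<longleftrightarrow>
     (\<forall>X m. X \<subseteq> S \<longrightarrow> X \<noteq> {} \<longrightarrow> is_glb P m X \<longrightarrow> m \<in> S) \<and>
     (\<forall>X j. X \<subseteq> S \<longrightarrow> X \<noteq> {} \<longrightarrow> is_lub P j X \<longrightarrow> j \<in> S)"

definition rde_hom :: "('o, 'm, 'b) prd \<Rightarrow> ('p, 'n, 'c) prd \<Rightarrow>
    ('o, 'm, 'b, 'p, 'n, 'c) prd_map set" where
  "rde_hom R R' = {(\<alpha>, \<mu>). (\<alpha>, \<mu>) \<in> prd_hom R R' \<and> rootoid R \<and> rootoid R' \<and>
     (\<forall>a\<in>Ob (Grp R).
        preserves_meets_joins (weak_right R a) (weak_right R' (on_ob \<alpha> a)) (on_mor \<alpha>) \<and>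
        adjunction_orthogonal R R' \<alpha> a \<and>
        inj_on (on_mor \<alpha>) (into (Grp R) a) \<and>
        closed_under_meets_joins (weak_right R' (on_ob \<alpha> a)) (on_mor \<alpha> ` into (Grp R) a))}"

definition rde_aut :: "('o, 'm, 'b) prd \<Rightarrow> ('o, 'm, 'b, 'o, 'm, 'b) prd_map set" where
  "rde_aut R = {f \<in> rde_hom R R. \<exists>f' \<in> rde_hom R R.
     prd_comp R f' f = prd_id R \<and> prd_comp R f f' = prd_id R}"

end

theory Submission
  imports Defs
begin

text \<open>
  The crux is the identity \<open>N(g \<omega>(b)) = N(\<omega>(a)) + N(g)\<close> for \<open>g : b \<rightarrow> a\<close>. By the cocycle rule
  \<open>\<Lambda>(g)(N(\<omega>(b))) = N(g) + N(g \<omega>(b))\<close>, and both summands lie below \<open>N(\<omega>(a))\<close>; the same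
  inequality for \<open>g\<inverse>\<close> gives \<open>\<Lambda>(g)(N(\<omega>(b))) = N(\<omega>(a))\<close>. Taking \<open>g = \<omega>(a)\<inverse>\<close> yields
  \<open>\<omega>(d(a)) = \<omega>(a)\<inverse>\<close>, and the cocycle rule then gives \<open>N(d(g)) = \<Lambda>(\<omega>(a)\<inverse>)(N(g))\<close>. Thus \<open>D\<close> is an
  involution of the protorootoid, hence an isomorphism of all the weak orders, from which the
  conditions on a local embedding follow.
\<close>

section \<open>Boolean rings\<close>

context boolean_rng
begin

text \<open>Expanding the square of the idempotent x + x gives (x + x) + (x + x); cancelling one
  copy shows that characteristic two is forced.\<close>

lemma add_self:
  assumes "x \<in> carrier B"
  shows "x \<oplus> x = \<zero>"
proof -
  have "(x \<oplus> x) \<oplus> (x \<oplus> x) = (x \<oplus> x) \<otimes> (x \<oplus> x)"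
    using assms by (simp only: distrib_right a_closed) (simp only: distrib_left mult_idem)
  also have "\<dots> = x \<oplus> x"
    using assms by (intro mult_idem) simp
  finally show ?thesis
    using assms add.l_cancel_one[of "x \<oplus> x" "x \<oplus> x"] by simp
qed

lemma add_eq_zero_iff:
  assumes "x \<in> carrier B" "y \<in> carrier B"
  shows "x \<oplus> y = \<zero> \<longleftrightarrow> x = y"
  using assms add_self[of y] add.right_cancel[of y x y] by auto

lemma add_add_cancel_left:
  assumes "x \<in> carrier B" "y \<in> carrier B"
  shows "x \<oplus> (x \<oplus> y) = y"
  using assms by (simp add: a_assoc[symmetric] add_self)

text \<open>Expanding the square of x + y leaves xy + yx = 0, and in characteristic two this says xy
  = yx.\<close>

lemma mult_comm:
  assumes "x \<in> carrier B" "y \<in> carrier B"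
  shows "x \<otimes> y = y \<otimes> x"
proof -
  have c: "x \<otimes> y \<in> carrier B" "y \<otimes> x \<in> carrier B"
    using assms mult_closed by auto
  have "x \<oplus> y = (x \<oplus> y) \<otimes> (x \<oplus> y)"
    using assms by (intro mult_idem[symmetric]) simp
  also have "\<dots> = (x \<oplus> y) \<oplus> (x \<otimes> y \<oplus> y \<otimes> x)"
    using assms c
    by (simp only: distrib_right a_closed) (simp only: distrib_left mult_idem, simp add: a_ac)
  finally have "x \<otimes> y \<oplus> y \<otimes> x = \<zero>"
    using assms c add.l_cancel_one'[of "x \<oplus> y" "x \<otimes> y \<oplus> y \<otimes> x"] by simp
  then show ?thesis
    using c add_eq_zero_iff by simp
qed

lemma brng_le_antisym:
  assumes "x \<in> carrier B" "y \<in> carrier B" "brng_le B x y" "brng_le B y x"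
  shows "x = y"
  using assms mult_comm unfolding brng_le_def by metis

text \<open>Distributivity gives (x + y)z = xz + yz. Through this closure property the additive
  cocycle rule interacts with the order.\<close>

lemma brng_le_add:
  assumes "x \<in> carrier B" "y \<in> carrier B" "z \<in> carrier B" "brng_le B x z" "brng_le B y z"
  shows "brng_le B (x \<oplus> y) z"
  using assms unfolding brng_le_def by (simp add: distrib_right)

end

section \<open>Homomorphisms of Boolean rings\<close>

lemma brng_hom_closed: "h \<in> brng_hom B B' \<Longrightarrow> x \<in> carrier B \<Longrightarrow> h x \<in> carrier B'"
  by (auto simp: brng_hom_def)

lemma brng_hom_add:
  "h \<in> brng_hom B B' \<Longrightarrow> x \<in> carrier B \<Longrightarrow> y \<in> carrier B \<Longrightarrow> h (x \<oplus>\<^bsub>B\<^esub> y) = h x \<oplus>\<^bsub>B'\<^esub> h y"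
  by (auto simp: brng_hom_def)

lemma brng_hom_mult:
  "h \<in> brng_hom B B' \<Longrightarrow> x \<in> carrier B \<Longrightarrow> y \<in> carrier B \<Longrightarrow> h (x \<otimes>\<^bsub>B\<^esub> y) = h x \<otimes>\<^bsub>B'\<^esub> h y"
  by (auto simp: brng_hom_def)

lemma brng_hom_le:
  "h \<in> brng_hom B B' \<Longrightarrow> x \<in> carrier B \<Longrightarrow> y \<in> carrier B \<Longrightarrow> brng_le B x y
    \<Longrightarrow> brng_le B' (h x) (h y)"
  unfolding brng_le_def by (metis brng_hom_mult)

text \<open>Additivity forces this: h(0) equals its own double, and doubles vanish in characteristic
  two.\<close>

lemma brng_hom_zero:
  assumes "boolean_rng B" "boolean_rng B'" "h \<in> brng_hom B B'"
  shows "h \<zero>\<^bsub>B\<^esub> = \<zero>\<^bsub>B'\<^esub>"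
proof -
  interpret B: boolean_rng B by fact
  interpret B': boolean_rng B' by fact
  have "h \<zero>\<^bsub>B\<^esub> = h (\<zero>\<^bsub>B\<^esub> \<oplus>\<^bsub>B\<^esub> \<zero>\<^bsub>B\<^esub>)"
    by simp
  also have "\<dots> = \<zero>\<^bsub>B'\<^esub>"
    using assms(3) by (simp only: brng_hom_add B.zero_closed) (simp add: B'.add_self brng_hom_closed)
  finally show ?thesis .
qed


section \<open>Order isomorphisms\<close>

text \<open>Infima, suprema, minima and \<open>perp\<close> refer only to the carrier and the
  relation, so they transport along such a bijection. Order axioms are assumed only in
  \<open>perp_image\<close>, for the minimum to exist and be unique.\<close>

locale gorder_iso =
  fixes P :: "'a gorder" and P' :: "'b gorder" and f :: "'a \<Rightarrow> 'b"
  assumes bij: "bij_betw f (carrier P) (carrier P')"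
    and le_iff: "\<lbrakk>x \<in> carrier P; y \<in> carrier P\<rbrakk> \<Longrightarrow> f x \<sqsubseteq>\<^bsub>P'\<^esub> f y \<longleftrightarrow> x \<sqsubseteq>\<^bsub>P\<^esub> y"
begin

lemma image_carrier: "f ` carrier P = carrier P'"
  using bij by (simp add: bij_betw_def)

lemma image_least: "least P l A \<Longrightarrow> least P' (f l) (f ` A)"
  unfolding least_def using le_iff image_carrier by blast

lemma image_greatest: "greatest P l A \<Longrightarrow> greatest P' (f l) (f ` A)"
  unfolding greatest_def using le_iff image_carrier by blast

lemma image_Upper:
  assumes "X \<subseteq> carrier P"
  shows "f ` Upper P X = Upper P' (f ` X)"
proof -
  have "f v \<in> Upper P' (f ` X) \<longleftrightarrow> v \<in> Upper P X" if "v \<in> carrier P" for v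
  proof -
    have "\<forall>x\<in>X. x \<in> carrier P \<and> f x \<in> carrier P' \<and> (f x \<sqsubseteq>\<^bsub>P'\<^esub> f v \<longleftrightarrow> x \<sqsubseteq>\<^bsub>P\<^esub> v)"
      using assms that image_carrier le_iff by auto
    then show ?thesis
      using that image_carrier by (auto simp: Upper_def)
  qed
  \<comment> \<open>The upper bounds of X form the preimage of the upper bounds of its image, so
    surjectivity of f onto \<open>carrier P'\<close> finishes the argument.\<close>
  then have "Upper P X = {v \<in> carrier P. f v \<in> Upper P' (f ` X)}"
    using Upper_closed[of P X] by blast
  then have "f ` Upper P X = f ` carrier P \<inter> Upper P' (f ` X)"
    by auto
  also have "\<dots> = Upper P' (f ` X)"
    using Upper_closed[of P' "f ` X"] by (simp only: image_carrier Int_absorb1)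
  finally show ?thesis .
qed

lemma image_Lower:
  assumes "X \<subseteq> carrier P"
  shows "f ` Lower P X = Lower P' (f ` X)"
proof -
  have "f v \<in> Lower P' (f ` X) \<longleftrightarrow> v \<in> Lower P X" if "v \<in> carrier P" for v
  proof -
    have "\<forall>x\<in>X. x \<in> carrier P \<and> f x \<in> carrier P' \<and> (f v \<sqsubseteq>\<^bsub>P'\<^esub> f x \<longleftrightarrow> v \<sqsubseteq>\<^bsub>P\<^esub> x)"
      using assms that image_carrier le_iff by auto
    then show ?thesis
      using that image_carrier by (auto simp: Lower_def)
  qed
  then have "Lower P X = {v \<in> carrier P. f v \<in> Lower P' (f ` X)}"
    using Lower_closed[of P X] by blast
  then have "f ` Lower P X = f ` carrier P \<inter> Lower P' (f ` X)"
    by auto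
  also have "\<dots> = Lower P' (f ` X)"
    using Lower_closed[of P' "f ` X"] by (simp only: image_carrier Int_absorb1)
  finally show ?thesis .
qed

lemma preserves_meets_joins: "preserves_meets_joins P P' f"
  unfolding preserves_meets_joins_def
proof (intro conjI allI impI)
  show "least P' (f x) (carrier P')" if "least P x (carrier P)" for x
    using image_least[OF that] by (simp add: image_carrier)
  show "is_glb P' (f m) (f ` X)" if "X \<subseteq> carrier P" "is_glb P m X" for X m
    using image_greatest[OF that(2)] by (simp add: image_Lower[OF that(1)])
  show "is_lub P' (f j) (f ` X)" if "X \<subseteq> carrier P" "is_lub P j X" for X j
    using image_least[OF that(2)] by (simp add: image_Upper[OF that(1)])
qed

text \<open>The image is the whole carrier, where meets and joins lie by definition.\<close>

lemma closed_under_meets_joins_image: "closed_under_meets_joins P' (f ` carrier P)"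
  unfolding closed_under_meets_joins_def image_carrier
  by (auto simp: least_def greatest_def Upper_def Lower_def)

text \<open>Because f reflects the relation, the candidates are exactly the elements above x, with
  minimum x. Antisymmetry makes this minimum unique, as the definite description in
  \<open>perp\<close> requires.\<close>

lemma perp_image:
  assumes refl: "\<And>x. x \<in> carrier P \<Longrightarrow> x \<sqsubseteq>\<^bsub>P\<^esub> x"
    and antisym: "\<And>x y. \<lbrakk>x \<in> carrier P; y \<in> carrier P; x \<sqsubseteq>\<^bsub>P\<^esub> y; y \<sqsubseteq>\<^bsub>P\<^esub> x\<rbrakk> \<Longrightarrow> x = y"
    and "x \<in> carrier P"
  shows "perp P P' f (f x) = x"
  unfolding perp_def
proof (rule the_equality)
  show "least P x {y \<in> carrier P. f x \<sqsubseteq>\<^bsub>P'\<^esub> f y}"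
    using assms le_iff unfolding least_def by blast
next
  fix m assume "least P m {y \<in> carrier P. f x \<sqsubseteq>\<^bsub>P'\<^esub> f y}"
  then show "m = x"
    using assms le_iff unfolding least_def by blast
qed

end


section \<open>Conjugation in a groupoid\<close>

lemma hom_setI: "f \<in> Mor C \<Longrightarrow> Dom C f = a \<Longrightarrow> Cod C f = b \<Longrightarrow> f \<in> hom_set C a b"
  by (simp add: hom_set_def)

lemma hom_setD:
  assumes "f \<in> hom_set C a b"
  shows "f \<in> Mor C" "Dom C f = a" "Cod C f = b"
  using assms by (simp_all add: hom_set_def)

section \<open>Calculus of morphisms and inverses\<close>

context small_category
begin

lemma hom_set_Ob:
  assumes "f \<in> hom_set C a b"
  shows "a \<in> Ob C" "b \<in> Ob C"
  using assms Dom_Ob Cod_Ob by (auto simp: hom_set_def)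

lemma Cmp_Ide_hom: "f \<in> hom_set C a b \<Longrightarrow> f \<cdot> Ide C a = f"
  using Cmp_Ide by (auto simp: hom_set_def)

lemma Ide_Cmp_hom: "f \<in> hom_set C a b \<Longrightarrow> Ide C b \<cdot> f = f"
  using Ide_Cmp by (auto simp: hom_set_def)

lemma is_inverse_hom:
  assumes "f \<in> hom_set C a b"
  shows "is_inverse C f g \<longleftrightarrow> g \<in> hom_set C b a \<and> g \<cdot> f = Ide C a \<and> f \<cdot> g = Ide C b"
  using assms by (auto simp: is_inverse_def hom_set_def)

lemma is_inverse_unique:
  assumes "f \<in> hom_set C a b" "is_inverse C f g" "is_inverse C f h"
  shows "g = h"
proof -
  have g: "g \<in> hom_set C b a" "g \<cdot> f = Ide C a" and h: "h \<in> hom_set C b a" "f \<cdot> h = Ide C b"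
    using assms by (simp_all add: is_inverse_hom)
  have "g = g \<cdot> (f \<cdot> h)"
    using g h by (simp add: Cmp_Ide_hom)
  also have "\<dots> = (g \<cdot> f) \<cdot> h"
    using Cmp_assoc[OF h(1) assms(1) g(1)] by simp
  also have "\<dots> = h"
    using g h by (simp add: Ide_Cmp_hom)
  finally show ?thesis .
qed

lemma inv_mor_eqI:
  assumes "f \<in> hom_set C a b" "is_inverse C f g"
  shows "inv_mor C f = g"
  unfolding inv_mor_def using assms(2) is_inverse_unique[OF assms(1) _ assms(2)]
  by (rule the_equality)

lemma id_functor_is_functor: "is_functor C C (id_functor C)"
  using Ide_hom Cmp_hom
  by unfold_locales (auto simp: id_functor_def hom_set_def dest: Dom_Ob Cod_Ob)

end

context groupoid
begin

lemma is_inverse_inv_mor: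
  assumes "f \<in> hom_set C a b"
  shows "is_inverse C f (inv_mor C f)"
proof -
  obtain g where "is_inverse C f g"
    using invertible[OF hom_setD(1)[OF assms]] by blast
  then show ?thesis
    using inv_mor_eqI[OF assms] by simp
qed

lemma inv_mor_hom:
  assumes "f \<in> hom_set C a b"
  shows "inv_mor C f \<in> hom_set C b a"
  using is_inverse_inv_mor[OF assms] by (simp add: is_inverse_hom[OF assms])

lemma inv_mor_Cmp:
  assumes "f \<in> hom_set C a b"
  shows "inv_mor C f \<cdot> f = Ide C a"
  using is_inverse_inv_mor[OF assms] by (simp add: is_inverse_hom[OF assms])

lemma Cmp_inv_mor:
  assumes "f \<in> hom_set C a b"
  shows "f \<cdot> inv_mor C f = Ide C b"
  using is_inverse_inv_mor[OF assms] by (simp add: is_inverse_hom[OF assms])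

lemma inv_mor_Cmp_cancel:
  assumes "f \<in> hom_set C a b" "g \<in> hom_set C c a"
  shows "inv_mor C f \<cdot> (f \<cdot> g) = g"
  using Cmp_assoc[OF assms(2,1) inv_mor_hom[OF assms(1)]]
  by (simp add: inv_mor_Cmp[OF assms(1)] Ide_Cmp_hom[OF assms(2)])

lemma Cmp_inv_mor_cancel:
  assumes "f \<in> hom_set C a b" "g \<in> hom_set C c b"
  shows "f \<cdot> (inv_mor C f \<cdot> g) = g"
  using Cmp_assoc[OF assms(2) inv_mor_hom[OF assms(1)] assms(1)]
  by (simp add: Cmp_inv_mor[OF assms(1)] Ide_Cmp_hom[OF assms(2)])

lemma inv_mor_inv_mor:
  assumes "f \<in> hom_set C a b"
  shows "inv_mor C (inv_mor C f) = f"
proof (rule inv_mor_eqI)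
  show i: "inv_mor C f \<in> hom_set C b a"
    using assms by (rule inv_mor_hom)
  show "is_inverse C (inv_mor C f) f"
    using assms by (simp add: is_inverse_hom[OF i] inv_mor_Cmp Cmp_inv_mor)
qed

end

text \<open>The identity functor transported along \<tau>: this value at f is the only one that
  makes \<tau> natural from the new functor to the identity. Later only the codomain of each
  \<tau>(a) is prescribed; its domain supplies the object map. The restrictions give the
  extensionality demanded by \<open>is_functor\<close>.\<close>

definition conj_functor :: "('o, 'm) cat \<Rightarrow> ('o \<Rightarrow> 'm) \<Rightarrow> ('o, 'm, 'o, 'm) cat_map" where
  "conj_functor C \<tau> = \<lparr>on_ob = (\<lambda>a\<in>Ob C. Dom C (\<tau> a)),
     on_mor = (\<lambda>f\<in>Mor C. inv_mor C (\<tau> (Cod C f)) \<cdot>\<^bsub>C\<^esub> (f \<cdot>\<^bsub>C\<^esub> \<tau> (Dom C f)))\<rparr>"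

context groupoid
begin

context
  fixes \<tau> :: "'a \<Rightarrow> 'b"
  assumes \<tau>: "\<And>a. a \<in> Ob C \<Longrightarrow> \<tau> a \<in> into C a"
begin

lemma conj_component_hom: "a \<in> Ob C \<Longrightarrow> \<tau> a \<in> hom_set C (on_ob (conj_functor C \<tau>) a) a"
  using \<tau> by (auto simp: conj_functor_def into_def hom_set_def)

lemma on_mor_conj_functor:
  "f \<in> hom_set C a b \<Longrightarrow> on_mor (conj_functor C \<tau>) f = inv_mor C (\<tau> b) \<cdot> (f \<cdot> \<tau> a)"
  by (simp add: conj_functor_def hom_set_def)

lemma conj_functor_hom:
  assumes "f \<in> hom_set C a b"
  shows "on_mor (conj_functor C \<tau>) f
    \<in> hom_set C (on_ob (conj_functor C \<tau>) a) (on_ob (conj_functor C \<tau>) b)"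
  unfolding on_mor_conj_functor[OF assms]
  using Cmp_hom[OF Cmp_hom[OF conj_component_hom assms] inv_mor_hom[OF conj_component_hom]]
    hom_set_Ob[OF assms] by blast

lemma conj_functor_natural:
  assumes "f \<in> hom_set C a b"
  shows "\<tau> b \<cdot> on_mor (conj_functor C \<tau>) f = f \<cdot> \<tau> a"
  unfolding on_mor_conj_functor[OF assms]
  using Cmp_inv_mor_cancel[OF conj_component_hom Cmp_hom[OF conj_component_hom assms]]
    hom_set_Ob[OF assms] by blast

text \<open>As \<tau>(b) is invertible, the naturality square determines the value at f. Functor
  laws, uniqueness and involutivity can thus be checked by verifying a square instead of
  manipulating inverses.\<close>

lemma conj_functor_eqI:
  assumes "f \<in> hom_set C a b" "g \<in> hom_set C (on_ob (conj_functor C \<tau>) a) (on_ob (conj_functor C \<tau>) b)"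
    and "\<tau> b \<cdot> g = f \<cdot> \<tau> a"
  shows "on_mor (conj_functor C \<tau>) f = g"
  unfolding on_mor_conj_functor[OF assms(1)] assms(3)[symmetric]
  using conj_component_hom[OF hom_set_Ob(2)[OF assms(1)]] assms(2) by (rule inv_mor_Cmp_cancel)

lemma conj_functor_is_functor: "is_functor C C (conj_functor C \<tau>)"
proof unfold_locales
  show "on_ob (conj_functor C \<tau>) \<in> extensional (Ob C)"
    "on_mor (conj_functor C \<tau>) \<in> extensional (Mor C)"
    by (simp_all add: conj_functor_def)
next
  fix a assume a: "a \<in> Ob C"
  show c: "on_ob (conj_functor C \<tau>) a \<in> Ob C"
    using conj_component_hom[OF a] by (rule hom_set_Ob(1))
  show "on_mor (conj_functor C \<tau>) (Ide C a) = Ide C (on_ob (conj_functor C \<tau>) a)"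
    using Ide_hom[OF a] Ide_hom[OF c]
  proof (rule conj_functor_eqI)
    show "\<tau> a \<cdot> Ide C (on_ob (conj_functor C \<tau>) a) = Ide C a \<cdot> \<tau> a"
      using conj_component_hom[OF a] by (simp add: Cmp_Ide_hom Ide_Cmp_hom)
  qed
next
  fix f a b assume "f \<in> hom_set C a b"
  then show "on_mor (conj_functor C \<tau>) f
      \<in> hom_set C (on_ob (conj_functor C \<tau>) a) (on_ob (conj_functor C \<tau>) b)"
    by (rule conj_functor_hom)
next
  fix f a b g c assume f: "f \<in> hom_set C a b" and g: "g \<in> hom_set C b c"
  let ?d = "on_mor (conj_functor C \<tau>)"
  have a: "\<tau> a \<in> hom_set C (on_ob (conj_functor C \<tau>) a) a"
    and b: "\<tau> b \<in> hom_set C (on_ob (conj_functor C \<tau>) b) b"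
    and c: "\<tau> c \<in> hom_set C (on_ob (conj_functor C \<tau>) c) c"
    using hom_set_Ob[OF f] hom_set_Ob[OF g] by (auto intro: conj_component_hom)
  have df: "?d f \<in> hom_set C (on_ob (conj_functor C \<tau>) a) (on_ob (conj_functor C \<tau>) b)"
    and dg: "?d g \<in> hom_set C (on_ob (conj_functor C \<tau>) b) (on_ob (conj_functor C \<tau>) c)"
    using f g by (auto intro: conj_functor_hom)
  show "?d (g \<cdot> f) = ?d g \<cdot> ?d f"
    using Cmp_hom[OF f g] Cmp_hom[OF df dg]
  proof (rule conj_functor_eqI)
    \<comment> \<open>The naturality squares of f and g are pasted together.\<close>
    have "\<tau> c \<cdot> (?d g \<cdot> ?d f) = (\<tau> c \<cdot> ?d g) \<cdot> ?d f"
      using Cmp_assoc[OF df dg c] by simp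
    also have "\<dots> = g \<cdot> (\<tau> b \<cdot> ?d f)"
      using Cmp_assoc[OF df b g] by (simp add: conj_functor_natural[OF g])
    also have "\<dots> = (g \<cdot> f) \<cdot> \<tau> a"
      using Cmp_assoc[OF a f g] by (simp add: conj_functor_natural[OF f])
    finally show "\<tau> c \<cdot> (?d g \<cdot> ?d f) = (g \<cdot> f) \<cdot> \<tau> a" .
  qed
qed

lemma conj_functor_natural_isomorphism:
  "natural_isomorphism C C (conj_functor C \<tau>) (id_functor C) \<tau>"
  unfolding natural_isomorphism_def natural_transformation_def
proof (intro conjI ballI)
  fix f assume "f \<in> Mor C"
  then show "on_mor (id_functor C) f \<cdot> \<tau> (Dom C f) = \<tau> (Cod C f) \<cdot> on_mor (conj_functor C \<tau>) f"
    using conj_functor_natural[of f "Dom C f" "Cod C f"] by (simp add: id_functor_def hom_setI)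
next
  fix a assume "a \<in> Ob C"
  then show "\<tau> a \<in> hom_set C (on_ob (conj_functor C \<tau>) a) (on_ob (id_functor C) a)"
    using conj_component_hom by (simp add: id_functor_def)
  then show "\<exists>g. is_inverse C (\<tau> a) g"
    using is_inverse_inv_mor by blast
qed (fact conj_functor_is_functor id_functor_is_functor)+

text \<open>The object d(a) must be the domain of \<tau>(a), and the naturality squares then fix d
  on morphisms. Extensionality turns this agreement on objects and morphisms into equality. This is
  the uniqueness in part (a).\<close>

lemma natural_isomorphism_eq_conj_functor:
  assumes "natural_isomorphism C C d (id_functor C) \<sigma>"
    and \<sigma>: "\<And>a. a \<in> Ob C \<Longrightarrow> \<sigma> a = \<tau> a"
  shows "d = conj_functor C \<tau>"
proof -
  interpret d: is_functor C C d
    using assms(1) by (simp add: natural_isomorphism_def natural_transformation_def)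
  interpret c: is_functor C C "conj_functor C \<tau>"
    by (rule conj_functor_is_functor)
  have hom: "\<tau> a \<in> hom_set C (on_ob d a) a" if "a \<in> Ob C" for a
    using that assms
    by (auto simp: natural_isomorphism_def natural_transformation_def id_functor_def)
  have ob: "on_ob d a = on_ob (conj_functor C \<tau>) a" if "a \<in> Ob C" for a
    using hom_setD(2)[OF hom[OF that]] hom_setD(2)[OF conj_component_hom[OF that]] by simp
  have "on_mor d f = on_mor (conj_functor C \<tau>) f" if f: "f \<in> Mor C" for f
  proof -
    have nat: "\<tau> (Cod C f) \<cdot> on_mor d f = f \<cdot> \<tau> (Dom C f)"
      using f assms Dom_Ob Cod_Ob
      by (simp add: natural_isomorphism_def natural_transformation_def id_functor_def)
    have fh: "f \<in> hom_set C (Dom C f) (Cod C f)"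
      using f by (simp add: hom_setI)
    have "on_mor d f \<in> hom_set C (on_ob (conj_functor C \<tau>) (Dom C f))
        (on_ob (conj_functor C \<tau>) (Cod C f))"
      using d.on_mor_hom[OF fh] f by (simp add: ob Dom_Ob Cod_Ob)
    then show ?thesis
      using conj_functor_eqI[OF fh _ nat] by simp
  qed
  with ob have "on_ob d = on_ob (conj_functor C \<tau>)" "on_mor d = on_mor (conj_functor C \<tau>)"
    using d.on_ob_ext c.on_ob_ext d.on_mor_ext c.on_mor_ext
    by (auto intro: extensionalityI)
  then show ?thesis
    by simp
qed

end

end


section \<open>Complements in a complete rootoid\<close>

context protorootoid
begin

lemma act_closed:
  "g \<in> hom_set (Grp R) b a \<Longrightarrow> x \<in> carrier (Lam R b) \<Longrightarrow> act R g x \<in> carrier (Lam R a)"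
  by (rule brng_hom_closed[OF act_hom])

lemma Nof_hom_closed: "g \<in> hom_set (Grp R) b a \<Longrightarrow> Nof R g \<in> carrier (Lam R a)"
  using Nof_closed[of g a] by (simp add: hom_set_def into_def)

text \<open>The cocycle rule for the composite of the identity with itself makes N of the identity
  equal to its own double, which vanishes.\<close>

lemma Nof_Ide:
  assumes "a \<in> Ob (Grp R)"
  shows "Nof R (Ide (Grp R) a) = \<zero>\<^bsub>Lam R a\<^esub>"
proof -
  interpret B: boolean_rng "Lam R a"
    using assms by (rule Lam_boolean)
  have i: "Ide (Grp R) a \<in> hom_set (Grp R) a a"
    using assms by (rule Ide_hom)
  have "Nof R (Ide (Grp R) a)
      = Nof R (Ide (Grp R) a) \<oplus>\<^bsub>Lam R a\<^esub> act R (Ide (Grp R) a) (Nof R (Ide (Grp R) a))"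
    using Nof_Cmp[OF i i] Cmp_Ide_hom[OF i] by simp
  also have "\<dots> = \<zero>\<^bsub>Lam R a\<^esub>"
    using assms i by (simp add: act_Ide Nof_hom_closed B.add_self)
  finally show ?thesis .
qed

lemma act_act_inv_mor:
  assumes "g \<in> hom_set (Grp R) b a" "x \<in> carrier (Lam R a)"
  shows "act R g (act R (inv_mor (Grp R) g) x) = x"
  using act_Cmp[OF inv_mor_hom[OF assms(1)] assms(1,2)] assms hom_set_Ob[OF assms(1)]
  by (simp add: Cmp_inv_mor[OF assms(1)] act_Ide)

end

section \<open>Maximum elements and complementation\<close>

context complete_rootoid
begin

lemma max_elt_greatest:
  assumes "a \<in> Ob (Grp R)"
  shows "greatest (weak_right R a) (max_elt R a) (into (Grp R) a)"
proof -
  interpret L: complete_lattice "weak_order R a"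
    using assms by (rule complete)
  have "greatest (weak_order R a) \<top>\<^bsub>weak_order R a\<^esub> (carrier (weak_order R a))"
    by (rule L.top_greatest)
  \<comment> \<open>The top of the weak order is some value N(g), and \<open>weak_right\<close>
    compares morphisms through N, so this g is greatest there.\<close>
  then obtain g where "greatest (weak_right R a) g (carrier (weak_right R a))"
    by (auto simp: greatest_def weak_order_def weak_right_def)
  \<comment> \<open>The top used in \<open>max_elt\<close> is a Hilbert choice among greatest
    elements, so existence suffices.\<close>
  then have "greatest (weak_right R a) (max_elt R a) (carrier (weak_right R a))"
    unfolding max_elt_def top_def by (rule someI)
  then show ?thesis
    by (simp add: weak_right_def)
qed

lemma max_elt_into: "a \<in> Ob (Grp R) \<Longrightarrow> max_elt R a \<in> into (Grp R) a"
  using max_elt_greatest by (simp add: greatest_def)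

lemma Nof_le_max_elt:
  "g \<in> hom_set (Grp R) b a \<Longrightarrow> brng_le (Lam R a) (Nof R g) (Nof R (max_elt R a))"
  using max_elt_greatest[of a] hom_set_Ob(2)[of g b a]
  by (auto simp: greatest_def weak_right_def hom_set_def into_def)

abbreviation dual :: "('a, 'b, 'a, 'b) cat_map" where
  "dual \<equiv> conj_functor (Grp R) (max_elt R)"

sublocale dual: is_functor "Grp R" "Grp R" dual
  using max_elt_into by (rule conj_functor_is_functor)

lemma max_elt_hom: "a \<in> Ob (Grp R) \<Longrightarrow> max_elt R a \<in> hom_set (Grp R) (on_ob dual a) a"
  using max_elt_into by (rule conj_component_hom)

lemma act_max_elt_le:
  assumes "g \<in> hom_set (Grp R) b a"
  shows "brng_le (Lam R a) (act R g (Nof R (max_elt R b))) (Nof R (max_elt R a))"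
proof -
  interpret B: boolean_rng "Lam R a"
    using assms by (intro Lam_boolean hom_set_Ob)
  have w: "max_elt R b \<in> hom_set (Grp R) (on_ob dual b) b"
    using assms by (intro max_elt_hom hom_set_Ob)
  have gw: "g \<cdot>\<^bsub>Grp R\<^esub> max_elt R b \<in> hom_set (Grp R) (on_ob dual b) a"
    using w assms by (rule Cmp_hom)
  have wa: "max_elt R a \<in> hom_set (Grp R) (on_ob dual a) a"
    using assms by (intro max_elt_hom hom_set_Ob)
  \<comment> \<open>The cocycle rule for g \<omega>(b) is solved for its last term by adding N(g) on
    both sides.\<close>
  have "act R g (Nof R (max_elt R b)) = Nof R g \<oplus>\<^bsub>Lam R a\<^esub> Nof R (g \<cdot>\<^bsub>Grp R\<^esub> max_elt R b)"
    using w assms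
    by (simp add: Nof_Cmp B.add_add_cancel_left Nof_hom_closed act_closed)
  then show ?thesis
    using B.brng_le_add Nof_hom_closed[OF assms] Nof_hom_closed[OF gw] Nof_hom_closed[OF wa]
      Nof_le_max_elt[OF assms] Nof_le_max_elt[OF gw] by simp
qed

text \<open>Applying the monotone map \<Lambda>(g) to \<open>act_max_elt_le\<close> for the inverse
  of g yields the inequality opposite to the one for g.\<close>

lemma act_max_elt:
  assumes "g \<in> hom_set (Grp R) b a"
  shows "act R g (Nof R (max_elt R b)) = Nof R (max_elt R a)"
proof -
  interpret B: boolean_rng "Lam R a"
    using assms by (intro Lam_boolean hom_set_Ob)
  have wa: "Nof R (max_elt R a) \<in> carrier (Lam R a)"
    using Nof_hom_closed[OF max_elt_hom] hom_set_Ob(2)[OF assms] by blast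
  have wb: "Nof R (max_elt R b) \<in> carrier (Lam R b)"
    using Nof_hom_closed[OF max_elt_hom] hom_set_Ob(1)[OF assms] by blast
  have inv: "inv_mor (Grp R) g \<in> hom_set (Grp R) a b"
    using assms by (rule inv_mor_hom)
  have "brng_le (Lam R a) (act R g (act R (inv_mor (Grp R) g) (Nof R (max_elt R a))))
      (act R g (Nof R (max_elt R b)))"
    using act_hom[OF assms] act_closed[OF inv wa] wb act_max_elt_le[OF inv] by (rule brng_hom_le)
  then have "brng_le (Lam R a) (Nof R (max_elt R a)) (act R g (Nof R (max_elt R b)))"
    using act_act_inv_mor[OF assms wa] by simp
  then show ?thesis
    using B.brng_le_antisym[OF act_closed[OF assms wb] wa act_max_elt_le[OF assms]] by simp
qed

text \<open>Since N(g) lies below N(\<omega>(a)), the sum is a relative complement: right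
  multiplication by the maximum acts on values as complementation in N(\<omega>(a)).\<close>

lemma Nof_Cmp_max_elt:
  assumes "g \<in> hom_set (Grp R) b a"
  shows "Nof R (g \<cdot>\<^bsub>Grp R\<^esub> max_elt R b) = Nof R g \<oplus>\<^bsub>Lam R a\<^esub> Nof R (max_elt R a)"
  using Nof_Cmp[OF max_elt_hom[OF hom_set_Ob(1)[OF assms]] assms] act_max_elt[OF assms] by simp

text \<open>Multiplying \<omega>(a)\<inverse> by \<omega>(a) gives an identity, whose value is 0. So
  the complement of N(\<omega>(a)\<inverse>) in the top value at d(a) is empty, the two values
  agree, and injectivity of N identifies the morphisms.\<close>

lemma max_elt_dual:
  assumes "a \<in> Ob (Grp R)"
  shows "max_elt R (on_ob dual a) = inv_mor (Grp R) (max_elt R a)"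
proof -
  let ?c = "on_ob dual a"
  let ?i = "inv_mor (Grp R) (max_elt R a)"
  have c: "?c \<in> Ob (Grp R)"
    using assms by (rule dual.on_ob_closed)
  have i: "?i \<in> hom_set (Grp R) a ?c"
    using assms by (intro inv_mor_hom max_elt_hom)
  interpret B: boolean_rng "Lam R ?c"
    using c by (rule Lam_boolean)
  have wc: "max_elt R ?c \<in> hom_set (Grp R) (on_ob dual ?c) ?c"
    using c by (rule max_elt_hom)
  have "Nof R ?i \<oplus>\<^bsub>Lam R ?c\<^esub> Nof R (max_elt R ?c) = Nof R (?i \<cdot>\<^bsub>Grp R\<^esub> max_elt R a)"
    using Nof_Cmp_max_elt[OF i] by simp
  also have "\<dots> = \<zero>\<^bsub>Lam R ?c\<^esub>"
    using inv_mor_Cmp[OF max_elt_hom[OF assms]] Nof_Ide[OF c] by simp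
  finally have "Nof R ?i = Nof R (max_elt R ?c)"
    using B.add_eq_zero_iff Nof_hom_closed[OF i] Nof_hom_closed[OF wc] by simp
  then show ?thesis
    using inj_onD[OF Nof_inj[OF c]] i wc by (auto simp: hom_set_def into_def)
qed

text \<open>The object d(d(a)) is the domain of \<omega>(d(a)) = \<omega>(a)\<inverse>, which is the
  codomain of \<omega>(a).\<close>

lemma dual_dual_ob:
  assumes "a \<in> Ob (Grp R)"
  shows "on_ob dual (on_ob dual a) = a"
  using max_elt_hom[OF dual.on_ob_closed[OF assms]] inv_mor_hom[OF max_elt_hom[OF assms]]
  unfolding max_elt_dual[OF assms] by (auto dest!: hom_setD(2))

text \<open>This is naturality of the inverse transformation \<omega>*. It serves both for d being
  an involution and for the naturality of \<Lambda>\<omega>*.\<close>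

lemma on_mor_dual_Cmp_inv_max_elt:
  assumes "g \<in> hom_set (Grp R) b a"
  shows "on_mor dual g \<cdot>\<^bsub>Grp R\<^esub> inv_mor (Grp R) (max_elt R b)
    = inv_mor (Grp R) (max_elt R a) \<cdot>\<^bsub>Grp R\<^esub> g"
proof -
  let ?wa = "max_elt R a" and ?wb = "max_elt R b"
  have wa: "?wa \<in> hom_set (Grp R) (on_ob dual a) a" and wb: "?wb \<in> hom_set (Grp R) (on_ob dual b) b"
    using max_elt_hom hom_set_Ob[OF assms] by blast+
  have gwb: "g \<cdot>\<^bsub>Grp R\<^esub> ?wb \<in> hom_set (Grp R) (on_ob dual b) a"
    using wb assms by (rule Cmp_hom)
  have "on_mor dual g = inv_mor (Grp R) ?wa \<cdot>\<^bsub>Grp R\<^esub> (g \<cdot>\<^bsub>Grp R\<^esub> ?wb)"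
    using max_elt_into assms by (rule on_mor_conj_functor)
  then have "on_mor dual g \<cdot>\<^bsub>Grp R\<^esub> inv_mor (Grp R) ?wb
      = inv_mor (Grp R) ?wa \<cdot>\<^bsub>Grp R\<^esub> ((g \<cdot>\<^bsub>Grp R\<^esub> ?wb) \<cdot>\<^bsub>Grp R\<^esub> inv_mor (Grp R) ?wb)"
    using Cmp_assoc[OF inv_mor_hom[OF wb] gwb inv_mor_hom[OF wa]] by simp
  also have "(g \<cdot>\<^bsub>Grp R\<^esub> ?wb) \<cdot>\<^bsub>Grp R\<^esub> inv_mor (Grp R) ?wb = g"
    using Cmp_assoc[OF inv_mor_hom[OF wb] wb assms] Cmp_inv_mor[OF wb] Cmp_Ide_hom[OF assms]
    by simp
  finally show ?thesis .
qed

lemma dual_dual_mor: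
  assumes "g \<in> Mor (Grp R)"
  shows "on_mor dual (on_mor dual g) = g"
proof -
  define b a where "b = Dom (Grp R) g" and "a = Cod (Grp R) g"
  have g: "g \<in> hom_set (Grp R) b a"
    using assms by (simp add: a_def b_def hom_setI)
  have ob: "a \<in> Ob (Grp R)" "b \<in> Ob (Grp R)"
    using g hom_set_Ob by auto
  have dg: "on_mor dual g \<in> hom_set (Grp R) (on_ob dual b) (on_ob dual a)"
    using g by (rule dual.on_mor_hom)
  show ?thesis
    using max_elt_into dg
  proof (rule conj_functor_eqI)
    show "g \<in> hom_set (Grp R) (on_ob dual (on_ob dual b)) (on_ob dual (on_ob dual a))"
      using g ob by (simp add: dual_dual_ob)
    \<comment> \<open>After replacing the maxima at d(a) and d(b) by inverses, the square
      characterizing d(d(g)) is the naturality square of \<omega>* at g.\<close>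
    show "max_elt R (on_ob dual a) \<cdot>\<^bsub>Grp R\<^esub> g = on_mor dual g \<cdot>\<^bsub>Grp R\<^esub> max_elt R (on_ob dual b)"
      using g ob by (simp add: max_elt_dual on_mor_dual_Cmp_inv_max_elt)
  qed
qed

text \<open>Two complementations cancel: the one from right multiplication by \<omega>(b), carried
  over by \<Lambda>(\<omega>(a)\<inverse>), and the one from left multiplication by
  \<omega>(a)\<inverse>.\<close>

lemma Nof_on_mor_dual:
  assumes "g \<in> hom_set (Grp R) b a"
  shows "Nof R (on_mor dual g) = act R (inv_mor (Grp R) (max_elt R a)) (Nof R g)"
proof -
  let ?c = "on_ob dual a"
  let ?i = "inv_mor (Grp R) (max_elt R a)"
  have ob: "a \<in> Ob (Grp R)" "b \<in> Ob (Grp R)" "?c \<in> Ob (Grp R)"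
    using assms hom_set_Ob dual.on_ob_closed by blast+
  interpret B: boolean_rng "Lam R ?c"
    using ob(3) by (rule Lam_boolean)
  interpret A: boolean_rng "Lam R a"
    using ob(1) by (rule Lam_boolean)
  have i: "?i \<in> hom_set (Grp R) a ?c"
    using ob by (intro inv_mor_hom max_elt_hom)
  have g: "Nof R g \<in> carrier (Lam R a)" and wa: "Nof R (max_elt R a) \<in> carrier (Lam R a)"
    and iN: "Nof R ?i \<in> carrier (Lam R ?c)"
    using assms i max_elt_hom[OF ob(1)] Nof_hom_closed by blast+
  \<comment> \<open>Maxima go to maxima under the action, and the maximum at d(a) is
    \<omega>(a)\<inverse> itself.\<close>
  have wc: "act R ?i (Nof R (max_elt R a)) = Nof R ?i"
    using act_max_elt[OF i] ob by (simp add: max_elt_dual)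
  have gw: "g \<cdot>\<^bsub>Grp R\<^esub> max_elt R b \<in> hom_set (Grp R) (on_ob dual b) a"
    using max_elt_hom[OF ob(2)] assms by (rule Cmp_hom)
  have "on_mor dual g = ?i \<cdot>\<^bsub>Grp R\<^esub> (g \<cdot>\<^bsub>Grp R\<^esub> max_elt R b)"
    using max_elt_into assms by (rule on_mor_conj_functor)
  then have "Nof R (on_mor dual g)
      = Nof R ?i \<oplus>\<^bsub>Lam R ?c\<^esub> act R ?i (Nof R (max_elt R a) \<oplus>\<^bsub>Lam R a\<^esub> Nof R g)"
    using Nof_Cmp[OF gw i] Nof_Cmp_max_elt[OF assms] A.a_comm[OF g wa] by simp
  also have "\<dots> = Nof R ?i \<oplus>\<^bsub>Lam R ?c\<^esub> (Nof R ?i \<oplus>\<^bsub>Lam R ?c\<^esub> act R ?i (Nof R g))"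
    using brng_hom_add[OF act_hom[OF i] wa g] wc by simp
  also have "\<dots> = act R ?i (Nof R g)"
    using iN act_closed[OF i g] by (rule B.add_add_cancel_left)
  finally show ?thesis .
qed


section \<open>The involution of a complete rootoid\<close>

text \<open>This is \<Lambda>\<omega>*; the nested restrictions supply the two levels of
  extensionality that \<open>prd_hom\<close> demands.\<close>

abbreviation dual_nat :: "'a \<Rightarrow> 'c \<Rightarrow> 'c" where
  "dual_nat \<equiv> \<lambda>a\<in>Ob (Grp R). \<lambda>x\<in>carrier (Lam R a). act R (inv_mor (Grp R) (max_elt R a)) x"

lemma inv_max_elt_hom:
  "a \<in> Ob (Grp R) \<Longrightarrow> inv_mor (Grp R) (max_elt R a) \<in> hom_set (Grp R) a (on_ob dual a)"
  by (intro inv_mor_hom max_elt_hom)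

lemma dual_prd_hom: "(dual, dual_nat) \<in> prd_hom R R"
  unfolding prd_hom_def mem_Collect_eq prod.case
proof (intro conjI ballI)
  fix a assume a: "a \<in> Ob (Grp R)"
  interpret A: boolean_rng "Lam R a"
    using a by (rule Lam_boolean)
  have "act R (inv_mor (Grp R) (max_elt R a)) \<in> brng_hom (Lam R a) (Lam R (on_ob dual a))"
    using a by (intro act_hom inv_max_elt_hom)
  then show "dual_nat a \<in> brng_hom (Lam R a) (Lam R (on_ob dual a))"
    using a by (auto simp: brng_hom_def A.mult_closed)
  show "dual_nat a \<in> extensional (carrier (Lam R a))"
    using a by simp
  fix g assume "g \<in> into (Grp R) a"
  then show "dual_nat a (Nof R g) = Nof R (on_mor dual g)"
    using a Nof_on_mor_dual[of g "Dom (Grp R) g" a] Nof_closed[of g a]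
    by (simp add: hom_set_def into_def)
next
  fix g x assume g: "g \<in> Mor (Grp R)" and x: "x \<in> carrier (Lam R (Dom (Grp R) g))"
  let ?a = "Cod (Grp R) g" and ?b = "Dom (Grp R) g"
  have gh: "g \<in> hom_set (Grp R) ?b ?a" and ob: "?a \<in> Ob (Grp R)" "?b \<in> Ob (Grp R)"
    using g Dom_Ob Cod_Ob by (auto simp: hom_setI)
  \<comment> \<open>The functor \<Lambda> is applied to the naturality square of \<omega>* at
    g.\<close>
  have "act R (inv_mor (Grp R) (max_elt R ?a)) (act R g x)
      = act R (on_mor dual g) (act R (inv_mor (Grp R) (max_elt R ?b)) x)"
    using act_Cmp[OF gh inv_max_elt_hom[OF ob(1)] x] on_mor_dual_Cmp_inv_max_elt[OF gh]
      act_Cmp[OF inv_max_elt_hom[OF ob(2)] dual.on_mor_hom[OF gh] x] by simp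
  then show "dual_nat ?a (act R g x) = act R (on_mor dual g) (dual_nat ?b x)"
    using ob x act_closed[OF gh x] by simp
qed (simp_all add: protorootoid_axioms dual.is_functor_axioms)

lemma prd_comp_dual_dual: "prd_comp R (dual, dual_nat) (dual, dual_nat) = prd_id R"
proof -
  have ob: "compose (Ob (Grp R)) (on_ob dual) (on_ob dual) = (\<lambda>a\<in>Ob (Grp R). a)"
    by (auto simp: compose_def dual_dual_ob intro!: restrict_ext)
  have mor: "compose (Mor (Grp R)) (on_mor dual) (on_mor dual) = (\<lambda>g\<in>Mor (Grp R). g)"
    by (auto simp: compose_def dual_dual_mor intro!: restrict_ext)
  have "compose (carrier (Lam R a)) (dual_nat (on_ob dual a)) (dual_nat a)
      = (\<lambda>x\<in>carrier (Lam R a). x)" if a: "a \<in> Ob (Grp R)" for a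
  proof (unfold compose_def, rule restrict_ext)
    fix x assume x: "x \<in> carrier (Lam R a)"
    \<comment> \<open>The second factor acts by the inverse of \<omega>(d(a)) =
      \<omega>(a)\<inverse>, that is, by \<omega>(a).\<close>
    have "dual_nat (on_ob dual a) (dual_nat a x)
      = act R (max_elt R a) (act R (inv_mor (Grp R) (max_elt R a)) x)"
      using a x dual.on_ob_closed[OF a] act_closed[OF inv_max_elt_hom[OF a] x]
        inv_mor_inv_mor[OF max_elt_hom[OF a]] by (simp add: max_elt_dual)
    also have "\<dots> = x"
      using act_act_inv_mor[OF max_elt_hom[OF a] x] .
    finally show "dual_nat (on_ob dual a) (dual_nat a x) = x" .
  qed
  then have "(\<lambda>a\<in>Ob (Grp R). compose (carrier (Lam R a)) (dual_nat (on_ob dual a)) (dual_nat a))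
      = (\<lambda>a\<in>Ob (Grp R). \<lambda>x\<in>carrier (Lam R a). x)"
    by (rule restrict_ext)
  then show ?thesis
    unfolding prd_comp_def prd_id_def comp_functor_def id_functor_def fst_conv snd_conv ob mor
    by (rule arg_cong)
qed

section \<open>The dual functor on the weak right orders\<close>

lemma dual_into:
  assumes "g \<in> into (Grp R) a"
  shows "on_mor dual g \<in> into (Grp R) (on_ob dual a)"
  using assms dual.on_mor_hom[of g "Dom (Grp R) g" a] by (auto simp: into_def hom_set_def)

lemma bij_betw_dual:
  assumes "a \<in> Ob (Grp R)"
  shows "bij_betw (on_mor dual) (into (Grp R) a) (into (Grp R) (on_ob dual a))"
proof (rule bij_betw_byWitness[where f' = "on_mor dual"])
  show "\<forall>g\<in>into (Grp R) a. on_mor dual (on_mor dual g) = g"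
    "\<forall>g\<in>into (Grp R) (on_ob dual a). on_mor dual (on_mor dual g) = g"
    by (simp_all add: into_def dual_dual_mor)
  show "on_mor dual ` into (Grp R) a \<subseteq> into (Grp R) (on_ob dual a)"
    using dual_into by blast
  show "on_mor dual ` into (Grp R) (on_ob dual a) \<subseteq> into (Grp R) a"
    using dual_into[of _ "on_ob dual a"] dual_dual_ob[OF assms] by auto
qed

lemma Nof_on_mor_dual_into:
  assumes "g \<in> into (Grp R) a"
  shows "Nof R (on_mor dual g) = act R (inv_mor (Grp R) (max_elt R a)) (Nof R g)"
  using assms Nof_on_mor_dual[of g "Dom (Grp R) g" a] by (simp add: into_def hom_set_def)

lemma act_max_elt_Nof_on_mor_dual:
  assumes "a \<in> Ob (Grp R)" "g \<in> into (Grp R) a"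
  shows "act R (max_elt R a) (Nof R (on_mor dual g)) = Nof R g"
  using act_act_inv_mor[OF max_elt_hom[OF assms(1)] Nof_closed[OF assms(2)]]
    Nof_on_mor_dual_into[OF assms(2)] by simp

text \<open>On values, d acts by \<Lambda>(\<omega>(a)\<inverse>), and \<Lambda>(\<omega>(a)) undoes
  it. Both are ring homomorphisms, hence monotone, so the order is preserved and reflected.\<close>

lemma dual_gorder_iso:
  assumes a: "a \<in> Ob (Grp R)"
  shows "gorder_iso (weak_right R a) (weak_right R (on_ob dual a)) (on_mor dual)"
proof
  show "bij_betw (on_mor dual) (carrier (weak_right R a)) (carrier (weak_right R (on_ob dual a)))"
    using bij_betw_dual[OF a] by (simp add: weak_right_def)
  fix x y assume "x \<in> carrier (weak_right R a)" "y \<in> carrier (weak_right R a)"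
  then have x: "x \<in> into (Grp R) a" and y: "y \<in> into (Grp R) a"
    by (simp_all add: weak_right_def)
  have "brng_le (Lam R (on_ob dual a)) (Nof R (on_mor dual x)) (Nof R (on_mor dual y))
      \<longleftrightarrow> brng_le (Lam R a) (Nof R x) (Nof R y)"
  proof
    assume "brng_le (Lam R (on_ob dual a)) (Nof R (on_mor dual x)) (Nof R (on_mor dual y))"
    from brng_hom_le[OF act_hom[OF max_elt_hom[OF a]] Nof_closed[OF dual_into[OF x]]
        Nof_closed[OF dual_into[OF y]] this]
    show "brng_le (Lam R a) (Nof R x) (Nof R y)"
      using a x y by (simp add: act_max_elt_Nof_on_mor_dual)
  next
    assume "brng_le (Lam R a) (Nof R x) (Nof R y)"
    from brng_hom_le[OF act_hom[OF inv_max_elt_hom[OF a]] Nof_closed[OF x] Nof_closed[OF y] this]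
    show "brng_le (Lam R (on_ob dual a)) (Nof R (on_mor dual x)) (Nof R (on_mor dual y))"
      using x y by (simp add: Nof_on_mor_dual_into)
  qed
  then show "on_mor dual x \<sqsubseteq>\<^bsub>weak_right R (on_ob dual a)\<^esub> on_mor dual y
      \<longleftrightarrow> x \<sqsubseteq>\<^bsub>weak_right R a\<^esub> y"
    by (simp add: weak_right_def)
qed

text \<open>Injectivity of N makes the weak right preorder antisymmetric, so
  \<open>perp_image\<close> applies and \<open>perp\<close> inverts d.\<close>

lemma perp_dual:
  assumes a: "a \<in> Ob (Grp R)" and g: "g \<in> into (Grp R) a"
  shows "perp (weak_right R a) (weak_right R (on_ob dual a)) (on_mor dual) (on_mor dual g) = g"
proof -
  interpret A: boolean_rng "Lam R a"
    using a by (rule Lam_boolean)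
  interpret I: gorder_iso "weak_right R a" "weak_right R (on_ob dual a)" "on_mor dual"
    using a by (rule dual_gorder_iso)
  show ?thesis
  proof (rule I.perp_image)
    show "g \<in> carrier (weak_right R a)"
      using g by (simp add: weak_right_def)
    show "x \<sqsubseteq>\<^bsub>weak_right R a\<^esub> x" if "x \<in> carrier (weak_right R a)" for x
      using that by (simp add: weak_right_def brng_le_def A.mult_idem Nof_closed)
    show "x = y" if "x \<in> carrier (weak_right R a)" "y \<in> carrier (weak_right R a)"
      "x \<sqsubseteq>\<^bsub>weak_right R a\<^esub> y" "y \<sqsubseteq>\<^bsub>weak_right R a\<^esub> x" for x y
      using that inj_onD[OF Nof_inj[OF a]] A.brng_le_antisym
      by (simp add: weak_right_def Nof_closed)
  qed
qed

lemma adjunction_orthogonal_dual: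
  assumes a: "a \<in> Ob (Grp R)"
  shows "adjunction_orthogonal R R dual a"
  unfolding adjunction_orthogonal_def
proof (intro ballI impI)
  let ?c = "on_ob dual a"
  fix g g'
  assume g: "g \<in> into (Grp R) a"
    and g': "g' \<in> order_ideal_of (weak_right R ?c) (on_mor dual ` into (Grp R) a)"
    and disj: "disjoint_at R ?c (Nof R (on_mor dual g)) (Nof R g')"
  \<comment> \<open>The order ideal lies in the set of morphisms into d(a), and d maps onto that
    set; hence g' = d(h), and \<open>perp\<close> sends g' to h.\<close>
  have "g' \<in> into (Grp R) ?c"
    using g' by (simp add: order_ideal_of_def weak_right_def)
  then obtain h where h: "h \<in> into (Grp R) a" and g'_eq: "g' = on_mor dual h"
    using bij_betw_dual[OF a] by (auto simp: bij_betw_def)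
  have w: "max_elt R a \<in> hom_set (Grp R) ?c a"
    using a by (rule max_elt_hom)
  \<comment> \<open>Disjointness is pulled back along \<Lambda>(\<omega>(a)), which respects
    products and zero.\<close>
  have "Nof R g \<otimes>\<^bsub>Lam R a\<^esub> Nof R h
      = act R (max_elt R a) (Nof R (on_mor dual g) \<otimes>\<^bsub>Lam R ?c\<^esub> Nof R (on_mor dual h))"
    using brng_hom_mult[OF act_hom[OF w] Nof_closed[OF dual_into[OF g]] Nof_closed[OF dual_into[OF h]]]
      act_max_elt_Nof_on_mor_dual[OF a g] act_max_elt_Nof_on_mor_dual[OF a h] by simp
  also have "\<dots> = \<zero>\<^bsub>Lam R a\<^esub>"
    using disj brng_hom_zero[OF Lam_boolean Lam_boolean act_hom[OF w]] hom_set_Ob[OF w]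
    by (simp add: disjoint_at_def g'_eq)
  finally show "disjoint_at R a (Nof R g)
      (Nof R (perp (weak_right R a) (weak_right R ?c) (on_mor dual) g'))"
    by (simp add: disjoint_at_def g'_eq perp_dual[OF a h])
qed

lemma dual_rde_hom: "(dual, dual_nat) \<in> rde_hom R R"
  unfolding rde_hom_def mem_Collect_eq prod.case
proof (intro conjI ballI)
  fix a assume a: "a \<in> Ob (Grp R)"
  interpret I: gorder_iso "weak_right R a" "weak_right R (on_ob dual a)" "on_mor dual"
    using a by (rule dual_gorder_iso)
  show "preserves_meets_joins (weak_right R a) (weak_right R (on_ob dual a)) (on_mor dual)"
    by (rule I.preserves_meets_joins)
  show "closed_under_meets_joins (weak_right R (on_ob dual a)) (on_mor dual ` into (Grp R) a)"
    using I.closed_under_meets_joins_image by (simp add: weak_right_def)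
  show "inj_on (on_mor dual) (into (Grp R) a)"
    using bij_betw_dual[OF a] by (simp add: bij_betw_def)
  show "adjunction_orthogonal R R dual a"
    using a by (rule adjunction_orthogonal_dual)
qed (fact dual_prd_hom rootoid_axioms)+

text \<open>As D squares to the identity, D itself is the required inverse.\<close>

lemma dual_rde_aut: "(dual, dual_nat) \<in> rde_aut R"
  unfolding rde_aut_def using dual_rde_hom prd_comp_dual_dual by blast

end

theorem corollary7p2:
  fixes R :: "('o, 'm, 'b) prd"
  assumes "complete_rootoid R"
  shows
    "(\<exists>!d. is_functor (Grp R) (Grp R) d \<and>
        (\<exists>\<omega>. natural_isomorphism (Grp R) (Grp R) d (id_functor (Grp R)) \<omega> \<and>
             (\<forall>a\<in>Ob (Grp R). \<omega> a = max_elt R a))) \<and>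
     (\<forall>d \<omega>. is_functor (Grp R) (Grp R) d \<longrightarrow>
        natural_isomorphism (Grp R) (Grp R) d (id_functor (Grp R)) \<omega> \<longrightarrow>
        (\<forall>a\<in>Ob (Grp R). \<omega> a = max_elt R a) \<longrightarrow>
        (let D = (d, \<lambda>a\<in>Ob (Grp R). \<lambda>x\<in>carrier (Lam R a). act R (inv_mor (Grp R) (\<omega> a)) x)
         in D \<in> rde_aut R \<and> prd_comp R D D = prd_id R))"
proof -
  interpret complete_rootoid R by fact
  \<comment> \<open>The transformation is prescribed on objects only, which already determines d;
    both parts thus reduce to the functor \<open>dual\<close>.\<close>
  have unique: "d = dual"
    if "natural_isomorphism (Grp R) (Grp R) d (id_functor (Grp R)) \<omega>"
      "\<forall>a\<in>Ob (Grp R). \<omega> a = max_elt R a" for d \<omega>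
    using natural_isomorphism_eq_conj_functor[OF max_elt_into that(1)] that(2) by blast
  have iso: "natural_isomorphism (Grp R) (Grp R) dual (id_functor (Grp R)) (max_elt R)"
    using max_elt_into by (rule conj_functor_natural_isomorphism)
  show ?thesis
  proof (intro conjI allI impI)
    show "\<exists>!d. is_functor (Grp R) (Grp R) d \<and>
        (\<exists>\<omega>. natural_isomorphism (Grp R) (Grp R) d (id_functor (Grp R)) \<omega> \<and>
             (\<forall>a\<in>Ob (Grp R). \<omega> a = max_elt R a))"
      using unique iso dual.is_functor_axioms by blast
  next
    fix d \<omega>
    assume "natural_isomorphism (Grp R) (Grp R) d (id_functor (Grp R)) \<omega>"
      and \<omega>: "\<forall>a\<in>Ob (Grp R). \<omega> a = max_elt R a"
    then have d: "d = dual"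
      by (rule unique)
    have "(\<lambda>a\<in>Ob (Grp R). \<lambda>x\<in>carrier (Lam R a). act R (inv_mor (Grp R) (\<omega> a)) x) = dual_nat"
      using \<omega> by (intro restrict_ext) simp
    then show "let D = (d, \<lambda>a\<in>Ob (Grp R). \<lambda>x\<in>carrier (Lam R a). act R (inv_mor (Grp R) (\<omega> a)) x)
         in D \<in> rde_aut R \<and> prd_comp R D D = prd_id R"
      unfolding Let_def d using dual_rde_aut prd_comp_dual_dual by simp
  qed
qed

end
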